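(* Let $H:[0,\infty)\to\mathbb R$ be a measurable function. The risk measure $R_H(X)$ is coherent if and only if there is some $\kappa\in[0,\frac12]$ such that $H(u)=\kappa u$ for all $u\in[0,\infty)$.
   Context: For a real-valued random variable $X$, $$R_H(X):=\mathsf E X+\mathsf E H(|X-\tilde X|),$$ where $\tilde X$ is an independent copy of $X$. $R_H(X)$ is defined when both expected values on the right are defined (possibly infinite) and are not infinite values of opposite signs. Random variables on a probability space rich enough to carry pairs of real-valued random variables with arbitrary joint distributions are considered. A risk measure $\rho$ (possibly with values $\pm\infty$) is coherent if it has the following properties, each required whenever the expressions involved are defined: translation invariance, $\rho(X+c)=\rho(X)+c$ for all $c\in\mathbb R$; subadditivity, $\rho(X+Y)\le\rho(X)+\rho(Y)$; positive homogeneity, $\rho(\lambda X)=\lambda\rho(X)$ for all real $\lambda\ge0$ (with $0\cdot(\pm\infty)=0$); and monotonicity, $\rho(X)\le\rho(Y)$ whenever $X\le Y$ (equivalently here, since $R_H(X)$ depends only on the distribution of $X$, whenever $\mathsf P(X>t)\le\mathsf P(Y>t)$ for all real $t$). *)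

theory Defs
  imports "HOL-Probability.Probability"
begin

text \<open>
  Extended expectation of a random variable: \<open>None\<close> if the positive and the negative part both
  have infinite expectation. (\<open>ennreal\<close> truncates negative arguments to 0, so the two
  integrals below are those of the positive and of the negative part.)
\<close>
definition ext_expectation :: "'a measure \<Rightarrow> ('a \<Rightarrow> real) \<Rightarrow> ereal option" where
  "ext_expectation M f =
     (let p = (\<integral>\<^sup>+ \<omega>. ennreal (f \<omega>) \<partial>M); n = (\<integral>\<^sup>+ \<omega>. ennreal (- f \<omega>) \<partial>M)
      in if p = \<infinity> \<and> n = \<infinity> then None else Some (enn2ereal p - enn2ereal n))"

text \<open>In \<open>ereal\<close>, \<open>\<infinity> + (-\<infinity>)\<close> has a junk value; this predicate excludes it.\<close>
definition sum_defined :: "ereal \<Rightarrow> ereal \<Rightarrow> bool" where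
  "sum_defined a b \<longleftrightarrow> \<not> (a = \<infinity> \<and> b = -\<infinity>) \<and> \<not> (a = -\<infinity> \<and> b = \<infinity>)"

definition partial_add :: "ereal option \<Rightarrow> ereal option \<Rightarrow> ereal option" where
  "partial_add x y =
     (case (x, y) of
        (Some a, Some b) \<Rightarrow> (if sum_defined a b then Some (a + b) else None)
      | _ \<Rightarrow> None)"

text \<open>
  The independent copy of \<open>X\<close> is realised on the product of \<open>M\<close> with itself, \<open>X\<close> being read
  off the first and its copy off the second coordinate. The lemmas \<open>copy_on_product\<close> and
  \<open>R_H_eq_indep_copy\<close> below show that these are independent and distributed as \<open>X\<close>, and that any
  other independent copy, on any probability space, gives the same value.
\<close>
definition R_H :: "'a measure \<Rightarrow> (real \<Rightarrow> real) \<Rightarrow> ('a \<Rightarrow> real) \<Rightarrow> ereal option" where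
  "R_H M H X = partial_add (ext_expectation M X)
     (ext_expectation (M \<Otimes>\<^sub>M M) (\<lambda>(\<omega>, \<omega>'). H \<bar>X \<omega> - X \<omega>'\<bar>))"

text \<open>A risk measure with values in \<open>[-\<infinity>, \<infinity>]\<close> that may be undefined (\<open>None\<close>) for some
  random variables; each property is required whenever all expressions in it are defined.
  In \<open>ereal\<close>, \<open>0 * (\<plusminus>\<infinity>) = 0\<close>.\<close>
definition coherent :: "'a measure \<Rightarrow> (('a \<Rightarrow> real) \<Rightarrow> ereal option) \<Rightarrow> bool" where
  "coherent M \<rho> \<longleftrightarrow>
     (\<forall>X\<in>borel_measurable M. \<forall>c::real. \<forall>a b.
        \<rho> X = Some a \<longrightarrow> \<rho> (\<lambda>\<omega>. X \<omega> + c) = Some b \<longrightarrow> b = a + ereal c) \<and>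
     (\<forall>X\<in>borel_measurable M. \<forall>Y\<in>borel_measurable M. \<forall>a b s.
        \<rho> X = Some a \<longrightarrow> \<rho> Y = Some b \<longrightarrow> \<rho> (\<lambda>\<omega>. X \<omega> + Y \<omega>) = Some s \<longrightarrow>
        sum_defined a b \<longrightarrow> s \<le> a + b) \<and>
     (\<forall>X\<in>borel_measurable M. \<forall>l::real. \<forall>a b.
        0 \<le> l \<longrightarrow> \<rho> X = Some a \<longrightarrow> \<rho> (\<lambda>\<omega>. l * X \<omega>) = Some b \<longrightarrow> b = ereal l * a) \<and>
     (\<forall>X\<in>borel_measurable M. \<forall>Y\<in>borel_measurable M. \<forall>a b.
        (AE \<omega> in M. X \<omega> \<le> Y \<omega>) \<longrightarrow> \<rho> X = Some a \<longrightarrow> \<rho> Y = Some b \<longrightarrow> a \<le> b)"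

text \<open>A probability space carrying pairs of real random variables with every joint distribution.\<close>
definition rich_prob_space :: "'a measure \<Rightarrow> bool" where
  "rich_prob_space M \<longleftrightarrow> prob_space M \<and>
     (\<forall>N :: (real \<times> real) measure. prob_space N \<longrightarrow> sets N = sets (borel \<Otimes>\<^sub>M borel) \<longrightarrow>
        (\<exists>X\<in>borel_measurable M. \<exists>Y\<in>borel_measurable M.
           distr M (borel \<Otimes>\<^sub>M borel) (\<lambda>\<omega>. (X \<omega>, Y \<omega>)) = N))"

lemma ext_expectation_distr:
  assumes "g \<in> measurable M N" "f \<in> borel_measurable N"
  shows "ext_expectation (distr M N g) f = ext_expectation M (\<lambda>\<omega>. f (g \<omega>))"
  using assms by (simp add: ext_expectation_def nn_integral_distr)

lemma copy_on_product:
  fixes X :: "'a \<Rightarrow> real"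
  assumes M: "prob_space M" and X[measurable]: "X \<in> borel_measurable M"
  shows "distr (M \<Otimes>\<^sub>M M) borel (\<lambda>p. X (fst p)) = distr M borel X"
    and "distr (M \<Otimes>\<^sub>M M) borel (\<lambda>p. X (snd p)) = distr M borel X"
    and "prob_space.indep_var (M \<Otimes>\<^sub>M M) borel (\<lambda>p. X (fst p)) borel (\<lambda>p. X (snd p))"
    and "distr (M \<Otimes>\<^sub>M M) (borel \<Otimes>\<^sub>M borel) (\<lambda>p. (X (fst p), X (snd p))) =
           distr M borel X \<Otimes>\<^sub>M distr M borel X"
proof -
  interpret M: prob_space M by (rule M)
  interpret P: pair_prob_space M M ..
  interpret D: prob_space "distr M borel X" by (rule M.prob_space_distr) simp
  show 1: "distr (M \<Otimes>\<^sub>M M) borel (\<lambda>p. X (fst p)) = distr M borel X"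
    using distr_distr[of X M borel fst "M \<Otimes>\<^sub>M M"]
    by (simp add: comp_def M.distr_pair_fst)
  show 2: "distr (M \<Otimes>\<^sub>M M) borel (\<lambda>p. X (snd p)) = distr M borel X"
  proof -
    have "distr (M \<Otimes>\<^sub>M M) M snd = M"
    proof (rule measure_eqI)
      fix A assume A: "A \<in> sets (distr (M \<Otimes>\<^sub>M M) M snd)"
      then have "A \<in> sets M" by simp
      moreover have "snd -` A \<inter> space (M \<Otimes>\<^sub>M M) = space M \<times> A"
        using sets.sets_into_space[OF \<open>A \<in> sets M\<close>] by (auto simp: space_pair_measure)
      ultimately show "emeasure (distr (M \<Otimes>\<^sub>M M) M snd) A = emeasure M A"
        by (simp add: emeasure_distr M.emeasure_pair_measure_Times M.emeasure_space_1)
    qed simp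
    then show ?thesis
      using distr_distr[of X M borel snd "M \<Otimes>\<^sub>M M"] by (simp add: comp_def)
  qed
  have sf: "sigma_finite_measure (distr M borel X)" by unfold_locales
  show 3: "distr (M \<Otimes>\<^sub>M M) (borel \<Otimes>\<^sub>M borel) (\<lambda>p. (X (fst p), X (snd p))) =
           distr M borel X \<Otimes>\<^sub>M distr M borel X"
    using pair_measure_distr[OF X X sf] by (simp add: case_prod_unfold)
  show "P.indep_var borel (\<lambda>p. X (fst p)) borel (\<lambda>p. X (snd p))"
    unfolding P.indep_var_distribution_eq by (simp add: 1 2 3)
qed

lemma R_H_eq_indep_copy:
  fixes X :: "'a \<Rightarrow> real" and Y Y' :: "'b \<Rightarrow> real"
  assumes M: "prob_space M" and X: "X \<in> borel_measurable M"
    and H: "H \<in> borel_measurable (restrict_space borel {0..})"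
    and N: "prob_space N"
    and dY: "distr N borel Y = distr M borel X" and dY': "distr N borel Y' = distr M borel X"
    and ind: "prob_space.indep_var N borel Y borel Y'"
  shows "R_H M H X =
    partial_add (ext_expectation M X) (ext_expectation N (\<lambda>\<omega>. H \<bar>Y \<omega> - Y' \<omega>\<bar>))"
proof -
  interpret N: prob_space N by (rule N)
  note [measurable] = X
  have [measurable]: "Y \<in> borel_measurable N" "Y' \<in> borel_measurable N"
    using N.indep_var_rv1[OF ind] N.indep_var_rv2[OF ind] by simp_all
  have "(\<lambda>p::real \<times> real. \<bar>fst p - snd p\<bar>) \<in>
      measurable (borel \<Otimes>\<^sub>M borel) (restrict_space borel {0..})"
    by (intro measurable_restrict_space2) auto
  from measurable_compose[OF this H]
  have h: "(\<lambda>p. H \<bar>fst p - snd p\<bar>) \<in> borel_measurable (borel \<Otimes>\<^sub>M borel)" .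
  have "distr N (borel \<Otimes>\<^sub>M borel) (\<lambda>\<omega>. (Y \<omega>, Y' \<omega>)) =
      distr (M \<Otimes>\<^sub>M M) (borel \<Otimes>\<^sub>M borel) (\<lambda>p. (X (fst p), X (snd p)))"
    using ind unfolding N.indep_var_distribution_eq by (simp add: dY dY' copy_on_product(4)[OF M X])
  then have "ext_expectation N (\<lambda>\<omega>. H \<bar>Y \<omega> - Y' \<omega>\<bar>) =
      ext_expectation (M \<Otimes>\<^sub>M M) (\<lambda>p. H \<bar>X (fst p) - X (snd p)\<bar>)"
    using ext_expectation_distr[OF _ h, of "\<lambda>\<omega>. (Y \<omega>, Y' \<omega>)" N]
      ext_expectation_distr[OF _ h, of "\<lambda>p. (X (fst p), X (snd p))" "M \<Otimes>\<^sub>M M"]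
    by simp
  then show ?thesis by (simp add: R_H_def case_prod_unfold)
qed

end

(* If R_H is coherent, homogeneity at 0 gives H 0 = 0, and homogeneity on a scaled indicator of an
   event of probability 1/2 gives H u = u * H 1.  Subadditivity for X and -X forces H 1 >= 0, and
   comparing the indicator of an event of probability p with the constant 1 gives 2 * p * H 1 <= 1 for
   all p < 1.  Conversely, for H u = k * u with k >= 0, the term E |X - X'| is finite exactly if X is
   integrable, so R_H X is either real (X integrable) or equal to the infinite value of E X (which is
   +infinity if k > 0), and all properties reduce to integrable variables.  Monotonicity then follows
   from |X - X'| <= |Y - Y'| + |D - D'| with D = Y - X >= 0 and E |D - D'| <= 2 * E D. *)
theory Submission
  imports Defs
begin

section \<open>Extended expectations through positive and negative parts\<close>

lemma ext_expectation_integrable: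
  assumes "integrable M f"
  shows "ext_expectation M f = Some (ereal (\<integral>x. f x \<partial>M))"
proof -
  have p: "(\<integral>\<^sup>+ x. ennreal (f x) \<partial>M) \<noteq> \<infinity>" and n: "(\<integral>\<^sup>+ x. ennreal (- f x) \<partial>M) \<noteq> \<infinity>"
    using assms by (auto simp: real_integrable_def)
  have "enn2ereal x - enn2ereal y = ereal (enn2real x - enn2real y)" if "x \<noteq> \<infinity>" "y \<noteq> \<infinity>" for x y
    using that by (cases x; cases y) auto
  with p n show ?thesis
    by (simp add: ext_expectation_def real_lebesgue_integral_def[OF assms])
qed

lemma ext_expectation_nonneg:
  assumes "\<And>x. 0 \<le> f x"
  shows "ext_expectation M f = Some (enn2ereal (\<integral>\<^sup>+ x. ennreal (f x) \<partial>M))"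
  using assms by (simp add: ext_expectation_def ennreal_neg zero_ennreal.rep_eq)

text \<open>As \<open>ennreal\<close> truncates at 0, these are integrals of positive parts, and
  taking positive parts is monotone and subadditive. Integrands of any sign are therefore
  allowed.\<close>

lemma nn_integral_ennreal_add_le:
  fixes f g :: "'a \<Rightarrow> real"
  assumes "f \<in> borel_measurable M" "g \<in> borel_measurable M" "\<And>x. h x \<le> f x + g x"
  shows "(\<integral>\<^sup>+ x. ennreal (h x) \<partial>M) \<le> (\<integral>\<^sup>+ x. ennreal (f x) \<partial>M) + (\<integral>\<^sup>+ x. ennreal (g x) \<partial>M)"
proof -
  have "ennreal (h x) \<le> ennreal (f x) + ennreal (g x)" for x
  proof -
    have "ennreal (h x) \<le> ennreal (max 0 (f x) + max 0 (g x))"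
      using assms(3)[of x] by (intro ennreal_leI) linarith
    also have "\<dots> = ennreal (f x) + ennreal (g x)"
      by (simp add: ennreal_plus max_def ennreal_neg)
    finally show ?thesis .
  qed
  then have "(\<integral>\<^sup>+ x. ennreal (h x) \<partial>M) \<le> (\<integral>\<^sup>+ x. ennreal (f x) + ennreal (g x) \<partial>M)"
    by (intro nn_integral_mono)
  also have "\<dots> = (\<integral>\<^sup>+ x. ennreal (f x) \<partial>M) + (\<integral>\<^sup>+ x. ennreal (g x) \<partial>M)"
    using assms by (intro nn_integral_add) auto
  finally show ?thesis .
qed

text \<open>This transfers finiteness of a single part between variables: with negated integrands it
  speaks of negative parts, and writing \<open>X\<close> as a sum minus the other summand gives
  converses.\<close>

lemma nn_integral_ennreal_add_finite:
  fixes f g :: "'a \<Rightarrow> real"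
  assumes "f \<in> borel_measurable M" "g \<in> borel_measurable M" "\<And>x. h x \<le> f x + g x"
    and "(\<integral>\<^sup>+ x. ennreal (f x) \<partial>M) < \<infinity>" "(\<integral>\<^sup>+ x. ennreal (g x) \<partial>M) < \<infinity>"
  shows "(\<integral>\<^sup>+ x. ennreal (h x) \<partial>M) < \<infinity>"
  using nn_integral_ennreal_add_le[OF assms(1-3)] assms(4,5)
  by (auto intro: le_less_trans)

lemma nn_integral_ennreal_cmult_finite_iff:
  fixes f :: "'a \<Rightarrow> real"
  assumes "f \<in> borel_measurable M" "0 < l"
  shows "(\<integral>\<^sup>+ x. ennreal (l * f x) \<partial>M) < \<infinity> \<longleftrightarrow> (\<integral>\<^sup>+ x. ennreal (f x) \<partial>M) < \<infinity>"
  using assms by (auto simp: ennreal_mult' nn_integral_cmult ennreal_mult_less_top)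

lemma integrable_iff_parts_finite:
  fixes f :: "'a \<Rightarrow> real"
  assumes "f \<in> borel_measurable M"
  shows "integrable M f \<longleftrightarrow>
    (\<integral>\<^sup>+ x. ennreal (f x) \<partial>M) < \<infinity> \<and> (\<integral>\<^sup>+ x. ennreal (- f x) \<partial>M) < \<infinity>"
  using assms by (auto simp: real_integrable_def less_top)

section \<open>The mean absolute difference of two independent copies\<close>

context prob_space
begin

text \<open>Both coordinate copies of \<open>f\<close> on the product have the distribution of
  \<open>f\<close>, and integrability and expectation depend on the distribution only.\<close>

lemma integral_fst_snd:
  fixes f :: "'a \<Rightarrow> real"
  assumes "integrable M f"
  shows "integrable (M \<Otimes>\<^sub>M M) (\<lambda>z. f (fst z))" "(\<integral>z. f (fst z) \<partial>(M \<Otimes>\<^sub>M M)) = expectation f"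
    and "integrable (M \<Otimes>\<^sub>M M) (\<lambda>z. f (snd z))" "(\<integral>z. f (snd z) \<partial>(M \<Otimes>\<^sub>M M)) = expectation f"
proof -
  have f[measurable]: "f \<in> borel_measurable M"
    using assms by simp
  have ps: "prob_space M"
    by unfold_locales
  have d: "integrable (M \<Otimes>\<^sub>M M) (\<lambda>z. f (g z)) \<and> (\<integral>z. f (g z) \<partial>(M \<Otimes>\<^sub>M M)) = expectation f"
    if "g \<in> measurable (M \<Otimes>\<^sub>M M) M" "distr (M \<Otimes>\<^sub>M M) borel (\<lambda>z. f (g z)) = distr M borel f" for g
  proof -
    have [measurable]: "g \<in> measurable (M \<Otimes>\<^sub>M M) M" by (rule that)
    have "integrable (distr (M \<Otimes>\<^sub>M M) borel (\<lambda>z. f (g z))) (\<lambda>x. x)"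
      unfolding that(2) using assms by (subst integrable_distr_eq) auto
    moreover have "(\<integral>x. x \<partial>distr (M \<Otimes>\<^sub>M M) borel (\<lambda>z. f (g z))) = expectation f"
      unfolding that(2) by (subst integral_distr) auto
    ultimately show ?thesis
      by (simp add: integrable_distr_eq integral_distr)
  qed
  show "integrable (M \<Otimes>\<^sub>M M) (\<lambda>z. f (fst z))" "(\<integral>z. f (fst z) \<partial>(M \<Otimes>\<^sub>M M)) = expectation f"
    using d[of fst] copy_on_product(1)[OF ps f] by auto
  show "integrable (M \<Otimes>\<^sub>M M) (\<lambda>z. f (snd z))" "(\<integral>z. f (snd z) \<partial>(M \<Otimes>\<^sub>M M)) = expectation f"
    using d[of snd] copy_on_product(2)[OF ps f] by auto
qed

text \<open>This is Gini's mean difference E |X - X'|. It is a Bochner integral, so it carries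
  information only for integrable \<open>X\<close>.\<close>

definition mean_difference :: "('a \<Rightarrow> real) \<Rightarrow> real" where
  "mean_difference X = (\<integral>z. \<bar>X (fst z) - X (snd z)\<bar> \<partial>(M \<Otimes>\<^sub>M M))"

lemma integrable_abs_diff:
  assumes "integrable M X"
  shows "integrable (M \<Otimes>\<^sub>M M) (\<lambda>z. \<bar>X (fst z) - X (snd z) :: real\<bar>)"
  using integral_fst_snd[OF assms] by auto

text \<open>By Fubini, almost every section of |X - X'| is integrable. One such section suffices,
  because it differs from \<open>X\<close> by a sign and a constant.\<close>

lemma integrable_abs_diff_iff:
  assumes [measurable]: "X \<in> borel_measurable M"
  shows "integrable (M \<Otimes>\<^sub>M M) (\<lambda>z. \<bar>X (fst z) - X (snd z) :: real\<bar>) \<longleftrightarrow> integrable M X"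
proof
  interpret P: pair_prob_space M M ..
  assume "integrable (M \<Otimes>\<^sub>M M) (\<lambda>z. \<bar>X (fst z) - X (snd z)\<bar>)"
  then have "AE x in M. integrable M (\<lambda>y. \<bar>X x - X y\<bar>)"
    using P.AE_integrable_fst' by fastforce
  \<comment> \<open>A property that holds almost everywhere holds at some point, since the total
    mass is 1.\<close>
  from eventually_happens[OF this]
  obtain x where "integrable M (\<lambda>y. \<bar>X x - X y\<bar>)"
    using not_empty by (auto simp: ae_filter_eq_bot_iff emeasure_space_1)
  then have "integrable M (\<lambda>y. X x - X y)"
    by (subst integrable_abs_iff[symmetric]) auto
  then have "integrable M (\<lambda>y. X x - (X x - X y))"
    by (rule Bochner_Integration.integrable_diff[rotated]) simp
  then show "integrable M X"
    by (simp only: diff_diff_eq2 add_diff_cancel_left')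
qed (rule integrable_abs_diff)

lemma mean_difference_translate: "mean_difference (\<lambda>x. X x + c) = mean_difference X"
  by (simp add: mean_difference_def)

lemma mean_difference_scale:
  assumes "0 \<le> l"
  shows "mean_difference (\<lambda>x. l * X x) = l * mean_difference X"
proof -
  have "\<bar>l * a - l * b\<bar> = l * \<bar>a - b\<bar>" for a b
    using assms by (simp add: abs_mult flip: right_diff_distrib)
  then show ?thesis
    by (simp add: mean_difference_def)
qed

lemma mean_difference_add_le:
  assumes "integrable M X" "integrable M Y"
  shows "mean_difference (\<lambda>x. X x + Y x) \<le> mean_difference X + mean_difference Y"
proof -
  note i = integrable_abs_diff[OF assms(1)] integrable_abs_diff[OF assms(2)]
  have "mean_difference (\<lambda>x. X x + Y x) \<le>
      (\<integral>z. \<bar>X (fst z) - X (snd z)\<bar> + \<bar>Y (fst z) - Y (snd z)\<bar> \<partial>(M \<Otimes>\<^sub>M M))"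
    unfolding mean_difference_def
    using i integrable_abs_diff[of "\<lambda>x. X x + Y x"] assms by (intro integral_mono) auto
  also have "\<dots> = mean_difference X + mean_difference Y"
    unfolding mean_difference_def using i by simp
  finally show ?thesis .
qed

text \<open>Triangle inequality |D - D'| \<le> |D| + |D'|. The factor 2 is what the bound 1/2 on
  \<open>\<kappa>\<close> compensates in the proof of monotonicity.\<close>

lemma mean_difference_le_abs:
  assumes "integrable M D"
  shows "mean_difference D \<le> 2 * expectation (\<lambda>x. \<bar>D x\<bar>)"
proof -
  have a: "integrable M (\<lambda>x. \<bar>D x\<bar>)"
    using assms by simp
  have "mean_difference D \<le> (\<integral>z. \<bar>D (fst z)\<bar> + \<bar>D (snd z)\<bar> \<partial>(M \<Otimes>\<^sub>M M))"
    unfolding mean_difference_def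
    using integral_fst_snd[OF a] integrable_abs_diff[OF assms] by (intro integral_mono) auto
  also have "\<dots> = 2 * expectation (\<lambda>x. \<bar>D x\<bar>)"
    using integral_fst_snd[OF a] by simp
  finally show ?thesis .
qed

section \<open>Sufficiency: linear \<open>H\<close> with slope in [0, 1/2]\<close>

lemma R_H_linear_integrable:
  assumes H: "\<And>u. 0 \<le> u \<Longrightarrow> H u = \<kappa> * u" and X: "integrable M X"
  shows "R_H M H X = Some (ereal (expectation X + \<kappa> * mean_difference X))"
proof -
  have "integrable (M \<Otimes>\<^sub>M M) (\<lambda>z. \<kappa> * \<bar>X (fst z) - X (snd z)\<bar>)"
    using integrable_abs_diff[OF X] by auto
  from ext_expectation_integrable[OF this] show ?thesis
    by (simp add: R_H_def H ext_expectation_integrable[OF X] case_prod_unfold partial_add_def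
        sum_defined_def mean_difference_def)
qed

text \<open>For nonintegrable \<open>X\<close> the second term is 0 or \<infinity>, so a defined
  value must agree with the infinite expectation of \<open>X\<close>. Each case records which parts
  are finite, so that cases for related variables can be matched by comparing parts.\<close>

lemma R_H_linear_cases:
  assumes H: "\<And>u. 0 \<le> u \<Longrightarrow> H u = \<kappa> * u" and \<kappa>: "0 \<le> \<kappa>"
    and X[measurable]: "X \<in> borel_measurable M" and R: "R_H M H X = Some a"
  obtains
    (finite) "integrable M X" "a = ereal (expectation X + \<kappa> * mean_difference X)"
      "(\<integral>\<^sup>+ x. ennreal (X x) \<partial>M) < \<infinity>" "(\<integral>\<^sup>+ x. ennreal (- X x) \<partial>M) < \<infinity>"
  | (PInf) "a = \<infinity>" "(\<integral>\<^sup>+ x. ennreal (X x) \<partial>M) = \<infinity>" "(\<integral>\<^sup>+ x. ennreal (- X x) \<partial>M) < \<infinity>"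
  | (MInf) "a = -\<infinity>" "(\<integral>\<^sup>+ x. ennreal (X x) \<partial>M) < \<infinity>" "(\<integral>\<^sup>+ x. ennreal (- X x) \<partial>M) = \<infinity>"
proof (cases "integrable M X")
  case True
  then show ?thesis
    using finite R_H_linear_integrable[OF H True] R integrable_iff_parts_finite[OF X] by auto
next
  case False
  let ?p = "\<integral>\<^sup>+ x. ennreal (X x) \<partial>M" and ?n = "\<integral>\<^sup>+ x. ennreal (- X x) \<partial>M"
  let ?d = "\<lambda>z. \<bar>X (fst z) - X (snd z)\<bar>"
  let ?t = "\<integral>\<^sup>+ z. ennreal (\<kappa> * ?d z) \<partial>(M \<Otimes>\<^sub>M M)"
  have "\<not> integrable (M \<Otimes>\<^sub>M M) ?d"
    using False integrable_abs_diff_iff[OF X] by simp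
  then have "(\<integral>\<^sup>+ z. ennreal (?d z) \<partial>(M \<Otimes>\<^sub>M M)) = \<infinity>"
    by (subst (asm) integrable_iff_bounded) (auto simp flip: less_top)
  \<comment> \<open>For \<open>\<kappa> = 0\<close> the integrand vanishes, although the mean
    difference is infinite.\<close>
  then have t: "?t = (if \<kappa> = 0 then 0 else \<infinity>)"
    using \<kappa> by (auto simp: ennreal_mult' nn_integral_cmult ennreal_mult_top)
  have "R_H M H X = partial_add (ext_expectation M X) (Some (enn2ereal ?t))"
    using \<kappa> by (simp add: R_H_def H case_prod_unfold ext_expectation_nonneg)
  then have R': "partial_add (ext_expectation M X) (Some (if \<kappa> = 0 then 0 else \<infinity>)) = Some a"
    using R t by (auto simp: zero_ennreal.rep_eq)
  have "?p = \<infinity> \<or> ?n = \<infinity>"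
    using False integrable_iff_parts_finite[OF X] by (auto simp: less_top)
  moreover have "\<not> (?p = \<infinity> \<and> ?n = \<infinity>)"
    using R' by (auto simp: ext_expectation_def partial_add_def)
  ultimately consider "?p = \<infinity>" "?n < \<infinity>" | "?p < \<infinity>" "?n = \<infinity>"
    by (auto simp: less_top)
  then show ?thesis
  proof cases
    case 1
    moreover from 1 have "ext_expectation M X = Some \<infinity>"
      by (cases ?n) (auto simp: ext_expectation_def)
    with R' have "a = \<infinity>"
      by (auto simp: partial_add_def sum_defined_def split: if_splits)
    ultimately show ?thesis
      using PInf by blast
  next
    case 2
    moreover from 2 have "ext_expectation M X = Some (-\<infinity>)"
      by (cases ?p) (auto simp: ext_expectation_def)
    \<comment> \<open>Definedness forces \<open>\<kappa> = 0\<close> here: otherwise the sum would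
      be -\<infinity> + \<infinity>.\<close>
    with R' have "a = -\<infinity>"
      by (auto simp: partial_add_def sum_defined_def split: if_splits)
    ultimately show ?thesis
      using MInf by blast
  qed
qed

lemma coherent_R_H_linear:
  assumes H: "\<And>u. 0 \<le> u \<Longrightarrow> H u = \<kappa> * u" and \<kappa>: "0 \<le> \<kappa>" "\<kappa> \<le> 1/2"
  shows "coherent M (R_H M H)"
proof -
  let ?P = "\<lambda>f. \<integral>\<^sup>+ x. ennreal (f x) \<partial>M"
  note R_cases = R_H_linear_cases[OF H \<kappa>(1)]
  note R_int = R_H_linear_integrable[of H \<kappa>, OF H]
  have translation: "b = a + ereal c"
    if X[measurable]: "X \<in> borel_measurable M" and a: "R_H M H X = Some a"
      and b: "R_H M H (\<lambda>\<omega>. X \<omega> + c) = Some b" for X c a b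
  proof -
    have Xc: "(\<lambda>\<omega>. X \<omega> + c) \<in> borel_measurable M"
      by simp
    \<comment> \<open>Shifting by \<open>c\<close> and back by \<open>- c\<close>; constants have
      finite parts on a probability space. With the same parts finite, both variables fall into the
      same case.\<close>
    have P: "?P (\<lambda>x. X x + c) < \<infinity> \<longleftrightarrow> ?P X < \<infinity>"
      using nn_integral_ennreal_add_finite[of X M "\<lambda>_. c" "\<lambda>x. X x + c"]
        nn_integral_ennreal_add_finite[of "\<lambda>x. X x + c" M "\<lambda>_. - c" X]
      by (auto simp: emeasure_space_1)
    have N: "?P (\<lambda>x. - (X x + c)) < \<infinity> \<longleftrightarrow> ?P (\<lambda>x. - X x) < \<infinity>"
      using nn_integral_ennreal_add_finite[of "\<lambda>x. - X x" M "\<lambda>_. - c" "\<lambda>x. - (X x + c)"]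
        nn_integral_ennreal_add_finite[of "\<lambda>x. - (X x + c)" M "\<lambda>_. c" "\<lambda>x. - X x"]
      by (auto simp: emeasure_space_1)
    show ?thesis
    proof (cases rule: R_cases[OF _ X a, consumes 0, case_names H finite PInf MInf])
      case finite
      then show ?thesis
        using R_int[of "\<lambda>\<omega>. X \<omega> + c"] b by (simp add: mean_difference_translate prob_space)
    next
      case PInf
      then show ?thesis
        using P N by (cases rule: R_cases[OF _ Xc b, consumes 0]) auto
    next
      case MInf
      then show ?thesis
        using P N by (cases rule: R_cases[OF _ Xc b, consumes 0]) auto
    qed
  qed
  have subadditivity: "s \<le> a + b"
    if X[measurable]: "X \<in> borel_measurable M" and Y[measurable]: "Y \<in> borel_measurable M"
      and a: "R_H M H X = Some a" and b: "R_H M H Y = Some b"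
      and s: "R_H M H (\<lambda>\<omega>. X \<omega> + Y \<omega>) = Some s" and ab: "sum_defined a b" for X Y a b s
  \<comment> \<open>If one summand is \<infinity>, definedness of \<open>a + b\<close> makes the
    right-hand side \<infinity>. Otherwise both positive parts are finite, hence also that of the
    sum, which rules out \<open>s = \<infinity>\<close>.\<close>
  proof (cases "a = \<infinity> \<or> b = \<infinity>")
    case True
    then show ?thesis
      using ab by (auto simp: sum_defined_def)
  next
    case False
    have XY: "(\<lambda>\<omega>. X \<omega> + Y \<omega>) \<in> borel_measurable M"
      by simp
    have PX: "?P X < \<infinity>"
      using False by (cases rule: R_cases[OF _ X a, consumes 0]) auto
    have PY: "?P Y < \<infinity>"
      using False by (cases rule: R_cases[OF _ Y b, consumes 0]) auto
    have PXY: "?P (\<lambda>x. X x + Y x) < \<infinity>"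
      using nn_integral_ennreal_add_finite[OF X Y _ PX PY] by simp
    show ?thesis
    proof (cases rule: R_cases[OF _ XY s, consumes 0, case_names H finite PInf MInf])
      case finite
      \<comment> \<open>Integrability of the summands is recovered from that of the sum: - X = - (X
        + Y) + Y, and the positive part of \<open>Y\<close> is finite.\<close>
      have "?P (\<lambda>x. - X x) < \<infinity>"
        using finite(4) PY nn_integral_ennreal_add_finite[of "\<lambda>x. - (X x + Y x)" M Y "\<lambda>x. - X x"]
        by simp
      then have iX: "integrable M X"
        using PX integrable_iff_parts_finite[OF X] by simp
      have "?P (\<lambda>x. - Y x) < \<infinity>"
        using finite(4) PX nn_integral_ennreal_add_finite[of "\<lambda>x. - (X x + Y x)" M X "\<lambda>x. - Y x"]
        by simp
      then have iY: "integrable M Y"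
        using PY integrable_iff_parts_finite[OF Y] by simp
      have "\<kappa> * mean_difference (\<lambda>x. X x + Y x) \<le> \<kappa> * mean_difference X + \<kappa> * mean_difference Y"
        using mult_left_mono[OF mean_difference_add_le[OF iX iY] \<kappa>(1)] by (simp add: algebra_simps)
      then show ?thesis
        using finite(2) iX iY R_int[OF _ iX] R_int[OF _ iY] a b by simp
    qed (use PXY in auto)
  qed
  have homogeneity: "b = ereal l * a"
    if X[measurable]: "X \<in> borel_measurable M" and l: "0 \<le> l" and a: "R_H M H X = Some a"
      and b: "R_H M H (\<lambda>\<omega>. l * X \<omega>) = Some b" for X l a b
  proof (cases "l = 0")
    \<comment> \<open>The left-hand side is the value at the zero variable, which is 0; the
      right-hand side is 0 even for infinite \<open>a\<close>.\<close>
    case True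
    then show ?thesis
      using b R_int[of "\<lambda>_. 0"] by (simp add: mean_difference_def flip: zero_ereal_def)
  next
    case False
    have lX: "(\<lambda>\<omega>. l * X \<omega>) \<in> borel_measurable M"
      by simp
    have l0: "0 < l"
      using l False by simp
    have P: "?P (\<lambda>x. l * X x) < \<infinity> \<longleftrightarrow> ?P X < \<infinity>"
      using l0 by (rule nn_integral_ennreal_cmult_finite_iff[OF X])
    have N: "?P (\<lambda>x. - (l * X x)) < \<infinity> \<longleftrightarrow> ?P (\<lambda>x. - X x) < \<infinity>"
      using nn_integral_ennreal_cmult_finite_iff[of "\<lambda>x. - X x" M l] l0 by simp
    show ?thesis
    proof (cases rule: R_cases[OF _ X a, consumes 0, case_names H finite PInf MInf])
      case finite
      then show ?thesis
        using R_int[of "\<lambda>\<omega>. l * X \<omega>"] b l by (simp add: mean_difference_scale algebra_simps)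
    next
      case PInf
      then show ?thesis
        using P N l0 by (cases rule: R_cases[OF _ lX b, consumes 0]) auto
    next
      case MInf
      then show ?thesis
        using P N l0 by (cases rule: R_cases[OF _ lX b, consumes 0]) auto
    qed
  qed
  have monotonicity: "a \<le> b"
    if X[measurable]: "X \<in> borel_measurable M" and Y[measurable]: "Y \<in> borel_measurable M"
      and le: "AE \<omega> in M. X \<omega> \<le> Y \<omega>" and a: "R_H M H X = Some a" and b: "R_H M H Y = Some b"
    for X Y a b
  proof -
    have P: "?P X \<le> ?P Y"
      using le by (intro nn_integral_mono_AE) (auto intro: ennreal_leI)
    have N: "?P (\<lambda>x. - Y x) \<le> ?P (\<lambda>x. - X x)"
      by (intro nn_integral_mono_AE eventually_mono[OF le]) (simp add: ennreal_leI)
    show ?thesis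
    proof (cases rule: R_cases[OF _ X a, consumes 0, case_names H finite PInf MInf])
      case X: finite
      show ?thesis
      proof (cases rule: R_cases[OF _ Y b, consumes 0, case_names H finite PInf MInf])
        case Y: finite
        let ?D = "\<lambda>x. Y x - X x"
        \<comment> \<open>The difference is taken as X - Y so that X = Y + (X - Y) fits
          subadditivity of the mean difference; its absolute value is almost everywhere Y -
          X.\<close>
        have imD: "integrable M (\<lambda>x. X x - Y x)"
          using X(1) Y(1) by auto
        have "expectation (\<lambda>x. \<bar>X x - Y x\<bar>) = expectation ?D"
          using le by (intro integral_cong_AE) auto
        then have "mean_difference (\<lambda>x. X x - Y x) \<le> 2 * expectation ?D"
          using mean_difference_le_abs[OF imD] by simp
        then have "mean_difference X \<le> mean_difference Y + 2 * expectation ?D"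
          using mean_difference_add_le[OF Y(1) imD] by simp
        then have "\<kappa> * mean_difference X \<le> \<kappa> * mean_difference Y + \<kappa> * (2 * expectation ?D)"
          using mult_left_mono[OF _ \<kappa>(1)] by (fastforce simp: distrib_left)
        \<comment> \<open>Here \<open>\<kappa> \<le> 1/2\<close> enters: the gain in mean difference
          is absorbed by E Y - E X.\<close>
        also have "\<kappa> * (2 * expectation ?D) \<le> 1/2 * (2 * expectation ?D)"
          using le by (intro mult_right_mono \<kappa>(2)) (auto intro!: integral_nonneg_AE)
        finally show ?thesis
          using X(1,2) Y(1,2) by (simp add: diff_divide_distrib)
      next
        \<comment> \<open>Impossible: the negative part of \<open>X\<close> dominates that of
          \<open>Y\<close>, and it has finite expectation.\<close>
        case MInf
        then show ?thesis
          using X(4) N by auto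
      qed auto
    next
      case PInf
      then have "?P Y = \<infinity>"
        using P by (auto simp: top_unique)
      then show ?thesis
        by (cases rule: R_cases[OF _ Y b, consumes 0]) auto
    qed auto
  qed
  show ?thesis
    unfolding coherent_def
    using translation subadditivity homogeneity monotonicity by blast
qed

section \<open>Necessity: test variables with two values\<close>

lemma R_H_zero: "R_H M H (\<lambda>_. 0) = Some (ereal (H 0))"
proof -
  interpret P: pair_prob_space M M ..
  have "ext_expectation (M \<Otimes>\<^sub>M M) (\<lambda>_. H 0) = Some (ereal (H 0))"
    by (subst ext_expectation_integrable) (auto simp: P.prob_space)
  then show ?thesis
    by (simp add: R_H_def case_prod_unfold ext_expectation_integrable[of M "\<lambda>_. 0", simplified]
        partial_add_def sum_defined_def)
qed

text \<open>The two copies differ, by |u|, exactly if one of them lies in \<open>A\<close> and the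
  other does not, which has probability 2 p (1 - p) for p the probability of \<open>A\<close>.
  Elsewhere \<open>H 0 = 0\<close> contributes nothing.\<close>

lemma R_H_scaled_indicator:
  assumes H: "H 0 = 0" and A[measurable]: "A \<in> events"
  shows "R_H M H (\<lambda>x. u * indicator A x) =
    Some (ereal (u * prob A + 2 * prob A * (1 - prob A) * H \<bar>u\<bar>))"
proof -
  let ?MM = "M \<Otimes>\<^sub>M M"
  let ?I = "indicator A :: 'a \<Rightarrow> real"
  let ?g = "\<lambda>z. H \<bar>u\<bar> * (?I (fst z) + ?I (snd z) - 2 * indicator (A \<times> A) z)"
  have I: "integrable M ?I"
    by (simp add: emeasure_eq_measure)
  have EI: "expectation ?I = prob A"
    by simp
  interpret P: pair_prob_space M M ..
  have AA: "A \<times> A \<in> sets ?MM"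
    by simp
  have iAA: "integrable ?MM (indicator (A \<times> A) :: _ \<Rightarrow> real)"
    using AA by (simp add: P.emeasure_eq_measure)
  have "measure ?MM (A \<times> A) = prob A * prob A"
    by (simp add: measure_def emeasure_pair_measure_Times enn2real_mult)
  then have mAA: "(\<integral>z. indicator (A \<times> A) z \<partial>?MM) = prob A * prob A"
    using AA by simp
  \<comment> \<open>The indicator of "exactly one coordinate in \<open>A\<close>" is the sum of the
    two indicators minus twice their product.\<close>
  have g: "(\<lambda>(x, y). H \<bar>u * ?I x - u * ?I y\<bar>) = ?g"
    by (auto simp: H fun_eq_iff indicator_def)
  have "integrable ?MM ?g"
    using integral_fst_snd[OF I] iAA by auto
  moreover have "(\<integral>z. ?g z \<partial>?MM) = H \<bar>u\<bar> * (prob A + prob A - 2 * (prob A * prob A))"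
    using integral_fst_snd[OF I] iAA mAA EI by simp
  ultimately have "ext_expectation ?MM (\<lambda>(x, y). H \<bar>u * ?I x - u * ?I y\<bar>) =
      Some (ereal (2 * prob A * (1 - prob A) * H \<bar>u\<bar>))"
    unfolding g by (subst ext_expectation_integrable) (auto simp: algebra_simps)
  moreover have "ext_expectation M (\<lambda>x. u * ?I x) = Some (ereal (u * prob A))"
    using I by (subst ext_expectation_integrable) auto
  ultimately show ?thesis
    by (simp add: R_H_def partial_add_def sum_defined_def)
qed

end

text \<open>Richness is applied to the law of a Bernoulli variable paired with the constant 0; the
  event is that the first variable equals 1.\<close>

lemma rich_prob_space_ex_event:
  assumes "rich_prob_space M" "0 \<le> p" "p \<le> 1"
  shows "\<exists>A\<in>sets M. measure M A = p"
proof -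
  let ?B = "borel \<Otimes>\<^sub>M borel :: (real \<times> real) measure"
  let ?f = "\<lambda>b. (of_bool b :: real, 0 :: real)"
  let ?N = "distr (measure_pmf (bernoulli_pmf p)) ?B ?f"
  have "prob_space ?N"
    by (intro measure_pmf.prob_space_distr) (simp add: space_pair_measure)
  with assms(1)[unfolded rich_prob_space_def, THEN conjunct2, rule_format, of ?N]
  obtain X Y where [measurable]: "X \<in> borel_measurable M" "Y \<in> borel_measurable M"
    and XY: "distr M ?B (\<lambda>\<omega>. (X \<omega>, Y \<omega>)) = ?N"
    by auto
  let ?S = "{1} \<times> UNIV :: (real \<times> real) set"
  have S: "?S \<in> sets ?B"
    by (rule pair_measureI) auto
  have "measure M ((\<lambda>\<omega>. (X \<omega>, Y \<omega>)) -` ?S \<inter> space M) = measure (distr M ?B (\<lambda>\<omega>. (X \<omega>, Y \<omega>))) ?S"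
    using S by (subst measure_distr) auto
  also have "\<dots> = measure (bernoulli_pmf p) {True}"
    unfolding XY using S by (subst measure_distr) (auto simp: space_pair_measure intro!: arg_cong[of _ _ "measure _"])
  also have "\<dots> = p"
    using assms(2,3) by (simp add: measure_pmf_single)
  moreover have "(\<lambda>\<omega>. (X \<omega>, Y \<omega>)) -` ?S \<inter> space M \<in> sets M"
    using S by (rule measurable_sets[rotated]) simp
  ultimately show ?thesis
    by metis
qed

lemma coherent_R_H_imp_linear:
  assumes rich: "rich_prob_space M" and coh: "coherent M (R_H M H)"
  shows "H 1 \<in> {0..1/2}" and "0 \<le> u \<Longrightarrow> H u = H 1 * u"
proof -
  interpret prob_space M
    using rich by (simp add: rich_prob_space_def)
  have subadd: "s \<le> a + b"
    if "X \<in> borel_measurable M" "Y \<in> borel_measurable M" "R_H M H X = Some (ereal a)"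
      "R_H M H Y = Some (ereal b)" "R_H M H (\<lambda>\<omega>. X \<omega> + Y \<omega>) = Some (ereal s)" for X Y a b s
  proof -
    have "ereal s \<le> ereal a + ereal b"
      by (rule coh[unfolded coherent_def, THEN conjunct2, THEN conjunct1, rule_format, OF that])
        (simp add: sum_defined_def)
    then show ?thesis by simp
  qed
  have hom: "b = l * a"
    if "X \<in> borel_measurable M" "0 \<le> l" "R_H M H X = Some (ereal a)"
      "R_H M H (\<lambda>\<omega>. l * X \<omega>) = Some (ereal b)" for X l a b
  proof -
    have "ereal b = ereal l * ereal a"
      by (rule coh[unfolded coherent_def, THEN conjunct2, THEN conjunct2, THEN conjunct1,
            rule_format, OF that])
    then show ?thesis by simp
  qed
  have mono: "a \<le> b"
    if "X \<in> borel_measurable M" "Y \<in> borel_measurable M" "AE \<omega> in M. X \<omega> \<le> Y \<omega>"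
      "R_H M H X = Some (ereal a)" "R_H M H Y = Some (ereal b)" for X Y a b
  proof -
    have "ereal a \<le> ereal b"
      by (rule coh[unfolded coherent_def, THEN conjunct2, THEN conjunct2, THEN conjunct2,
            rule_format, OF that])
    then show ?thesis by simp
  qed
  \<comment> \<open>Homogeneity with factor 0 at the zero variable, whose value is
    \<open>H 0\<close>, gives H 0 = 0 * H 0.\<close>
  have H0: "H 0 = 0"
    using hom[of "\<lambda>_. 0" 0 "H 0" "H 0"] by (simp add: R_H_zero)
  note R = R_H_scaled_indicator[of H, OF H0]
  obtain A where A[measurable]: "A \<in> events" and pA: "prob A = 1/2"
    using rich_prob_space_ex_event[OF rich, of "1/2"] by auto
  have RA: "R_H M H (\<lambda>x. u * indicator A x) = Some (ereal (u / 2 + H \<bar>u\<bar> / 2))" for u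
    using R[OF A, of u] pA by simp
  show "H u = H 1 * u" if "0 \<le> u"
    using hom[of "\<lambda>x. 1 * indicator A x" u "1 / 2 + H 1 / 2" "u / 2 + H u / 2"] RA[of 1] RA[of u] that
    by (simp add: algebra_simps)
  \<comment> \<open>The indicator of \<open>A\<close> and its negative add up to 0; their
    expectations cancel and leave 0 \<le> H 1.\<close>
  have "0 \<le> (1 / 2 + H 1 / 2) + (- 1 / 2 + H 1 / 2)"
  proof (rule subadd)
    show "R_H M H (\<lambda>x. 1 * indicator A x) = Some (ereal (1 / 2 + H 1 / 2))"
      using RA[of 1] by simp
    show "R_H M H (\<lambda>x. - 1 * indicator A x) = Some (ereal (- 1 / 2 + H 1 / 2))"
      using RA[of "- 1"] by simp
    show "R_H M H (\<lambda>x. 1 * indicator A x + - 1 * indicator A x) = Some (ereal 0)"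
      using R_H_zero[of H] H0 by simp
  qed auto
  moreover have "H 1 \<le> 1/2"
  proof (rule ccontr)
    assume less: "\<not> H 1 \<le> 1/2"
    \<comment> \<open>Monotonicity between the indicator of \<open>B\<close> and 1, after cancelling
      the positive factor 1 - p.\<close>
    have bound: "2 * p * H 1 \<le> 1" if p: "0 \<le> p" "p < 1" for p
    proof -
      obtain B where B[measurable]: "B \<in> events" and pB: "prob B = p"
        using rich_prob_space_ex_event[OF rich, of p] p by auto
      have "p + 2 * p * (1 - p) * H 1 \<le> 1"
      proof (rule mono)
        show "R_H M H (\<lambda>x. 1 * indicator B x) = Some (ereal (p + 2 * p * (1 - p) * H 1))"
          using R[OF B, of 1] pB by simp
        show "R_H M H (\<lambda>x. 1 * indicator (space M) x) = Some (ereal 1)"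
          using R[OF sets.top, of 1] by (simp add: prob_space)
      qed (auto simp: indicator_def)
      then have "(1 - p) * (2 * p * H 1) \<le> (1 - p) * 1"
        by (simp add: algebra_simps)
      then show ?thesis
        using p mult_le_cancel_left_pos[of "1 - p"] by simp
    qed
    \<comment> \<open>If H 1 > 1/2, there is room for a probability p strictly between 1 / (2 * H 1)
      and 1, which violates \<open>bound\<close>.\<close>
    have "1 / (2 * H 1) < 1" "0 \<le> 1 / (2 * H 1)"
      using less by (auto simp: field_simps)
    then obtain p where p: "1 / (2 * H 1) < p" "p < 1"
      using dense by blast
    then have "1 < 2 * p * H 1"
      using less by (simp add: field_simps)
    with bound[of p] p \<open>0 \<le> 1 / (2 * H 1)\<close> show False
      by simp
  qed
  ultimately show "H 1 \<in> {0..1/2}"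
    by simp
qed

theorem proposition4p3:
  fixes M :: "'a measure" and H :: "real \<Rightarrow> real"
  assumes "rich_prob_space M"
    and "H \<in> borel_measurable (restrict_space borel {0..})"
  shows "coherent M (R_H M H) \<longleftrightarrow> (\<exists>\<kappa>\<in>{0..1/2}. \<forall>u\<in>{0..}. H u = \<kappa> * u)"
proof
  assume "coherent M (R_H M H)"
  note lin = coherent_R_H_imp_linear[OF assms(1) this]
  show "\<exists>\<kappa>\<in>{0..1/2}. \<forall>u\<in>{0..}. H u = \<kappa> * u"
    by (intro bexI[of _ "H 1"] ballI lin) simp
next
  interpret prob_space M
    using assms(1) by (simp add: rich_prob_space_def)
  assume "\<exists>\<kappa>\<in>{0..1/2}. \<forall>u\<in>{0..}. H u = \<kappa> * u"
  then obtain \<kappa> where "0 \<le> \<kappa>" "\<kappa> \<le> 1/2" "\<And>u. 0 \<le> u \<Longrightarrow> H u = \<kappa> * u"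
    by auto
  then show "coherent M (R_H M H)"
    by (intro coherent_R_H_linear)
qed

end
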